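(* Let $$\tilde P(z)=\frac12\sum_{1\le i<j\le n}a_ia_j(z_i-z_j)^2\log(z_i-z_j)$$ (a multivalued function on $\mathbb C^n-\Delta$). Then for all $i,j\in J$ and $z\in\mathbb C^n-\Delta$, $$d\Big(\frac{\partial^2\tilde P}{\partial z_i\partial z_j}\Big)=-\,\tilde\eta(\partial_i)*_z\tilde\eta(\partial_j).$$
   Context: Let $n\ge2$, $J=\{1,\dots,n\}$, and let $\Delta\subset\mathbb C^n$ be the union of hyperplanes $z_i=z_j$, $i<j$. Fix weights $a_j\in\mathbb C\setminus\{0\}$ with $|a|:=\sum_ja_j\ne0$. Put $f_j(z,t)=z_j+t$ on $\mathbb C^n\times\mathbb C$. For $z\in\mathbb C^n-\Delta$ let $U(z)=\mathbb C-\{-z_1,\dots,-z_n\}$, $\Phi(z,t)=\sum_ja_j\log(z_j+t)$, $A_\Phi(z)=\mathbb C(U(z))/\langle\partial\Phi/\partial t\rangle$, where $\mathbb C(U(z))$ is the algebra of rational functions on $\mathbb C$ regular on $U(z)$. The residue form on $A_\Phi(z)$ is $([g],[h])_z=\sum_p\frac1{2\pi\sqrt{-1}}\int_{\Gamma_p}\frac{gh\,dt}{\partial\Phi/\partial t}$, the sum over critical points $p\in U(z)$ of $\Phi(z,\cdot)$, $\Gamma_p$ being a small positively oriented circle around $p$. Write $\partial_j=\partial/\partial z_j$. Let $\beta(z):T_z(\mathbb C^n-\Delta)\to A_\Phi(z)$, $\partial_j\mapsto[a_j/f_j]$, and let $\eta$ be the bilinear form on $T_z(\mathbb C^n-\Delta)$,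 $\eta(u,v)=(\beta(z)u,\beta(z)v)_z$; explicitly $\eta(\partial_j,\partial_j)=-a_j+a_j^2/|a|$ and $\eta(\partial_i,\partial_j)=a_ia_j/|a|$ for $i\ne j$. Let $\tilde\eta:T_z(\mathbb C^n-\Delta)\to T_z^*(\mathbb C^n-\Delta)$, $u\mapsto\eta(u,\cdot)$; explicitly $\tilde\eta(\partial_j)=dp_j$ with $p_j=a_j\big(-z_j+\sum_{i}\frac{a_i}{|a|}z_i\big)$. Its kernel is spanned by $\sum_j\partial_j$. Let $B^*(z)=\tilde\eta(T_z(\mathbb C^n-\Delta))$. The multiplication $*_z$ on $T_z(\mathbb C^n-\Delta)$ is the bilinear one with $\partial_i*_z\partial_j=\frac{a_i}{z_i-z_j}\partial_j+\frac{a_j}{z_j-z_i}\partial_i$ for $i\ne j$ and $\partial_i*_z\partial_i=-\sum_{j\ne i}\partial_i*_z\partial_j$; the vector $\sum_j\partial_j$ has zero product with everything, and $\beta(z)$ is an algebra homomorphism. The multiplication on $B^*(z)$ is the induced one: $\tilde\eta(u)*_z\tilde\eta(v)=\tilde\eta(u*_zv)$. *)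

theory Defs
  imports "HOL-Complex_Analysis.Complex_Analysis" "HOL-Algebra.QuotRing"
begin

text \<open>
  The index set \<open>J = {1,\<dots>,n}\<close> is a finite linearly ordered type \<open>'n\<close>, and the tangent spaces
  of \<open>\<complex>\<^sup>n\<close> are identified with \<open>complex^'n\<close>, the vector field \<open>\<partial>\<^sub>j\<close> being \<open>axis j 1\<close>.
  Covectors are functions \<open>complex^'n \<Rightarrow> complex\<close>.
\<close>

definition Delta :: "(complex ^ 'n::{finite,linorder}) set" where
  "Delta = {z. \<exists>i j. i < j \<and> z $ i = z $ j}"

definition f_lin :: "'n \<Rightarrow> complex ^ 'n::finite \<Rightarrow> complex \<Rightarrow> complex" where
  "f_lin j z t = z $ j + t"

definition U_set :: "complex ^ 'n::finite \<Rightarrow> complex set" where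
  "U_set z = UNIV - range (\<lambda>j. - (z $ j))"

definition log_branch_on :: "'a::topological_space set \<Rightarrow> ('a \<Rightarrow> complex) \<Rightarrow> ('a \<Rightarrow> complex) \<Rightarrow> bool" where
  "log_branch_on W g l \<longleftrightarrow> continuous_on W l \<and> (\<forall>w\<in>W. exp (l w) = g w)"

text \<open>
  \<open>\<Phi>(z,t) = \<Sum>\<^sub>j a\<^sub>j log (z\<^sub>j + t)\<close> is multivalued, but its \<open>t\<close>-derivative is single-valued on \<open>U_set z\<close>;
  \<open>dPhi_branch\<close> below shows that the following function is the derivative of every local branch.
\<close>

definition dPhi :: "('n \<Rightarrow> complex) \<Rightarrow> complex ^ 'n::finite \<Rightarrow> complex \<Rightarrow> complex" where
  "dPhi a z t = (\<Sum>j\<in>UNIV. a j / f_lin j z t)"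

definition crit :: "('n \<Rightarrow> complex) \<Rightarrow> complex ^ 'n::finite \<Rightarrow> complex set" where
  "crit a z = {p \<in> U_set z. dPhi a z p = 0}"

text \<open>
  A rational function regular on the cofinite set \<open>V\<close> is represented by its values on \<open>V\<close>,
  extended by \<open>0\<close> outside \<open>V\<close> so that equality of functions is equality of rational functions.
\<close>

definition ext0 :: "complex set \<Rightarrow> (complex \<Rightarrow> complex) \<Rightarrow> complex \<Rightarrow> complex" where
  "ext0 V g t = (if t \<in> V then g t else 0)"

definition regular_functions :: "complex set \<Rightarrow> (complex \<Rightarrow> complex) ring" where
  "regular_functions V =
     \<lparr>carrier = {ext0 V (\<lambda>t. poly p t / poly q t) | p q. \<forall>t\<in>V. poly q t \<noteq> 0},
      monoid.mult = (\<lambda>g h t. g t * h t),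
      one = ext0 V (\<lambda>t. 1),
      zero = (\<lambda>t. 0),
      add = (\<lambda>g h t. g t + h t)\<rparr>"

definition crit_ideal :: "('n \<Rightarrow> complex) \<Rightarrow> complex ^ 'n::finite \<Rightarrow> (complex \<Rightarrow> complex) set" where
  "crit_ideal a z = genideal (regular_functions (U_set z)) {ext0 (U_set z) (dPhi a z)}"

definition A_Phi :: "('n \<Rightarrow> complex) \<Rightarrow> complex ^ 'n::finite \<Rightarrow> (complex \<Rightarrow> complex) set ring" where
  "A_Phi a z = regular_functions (U_set z) Quot crit_ideal a z"

definition cls :: "('n \<Rightarrow> complex) \<Rightarrow> complex ^ 'n::finite \<Rightarrow> (complex \<Rightarrow> complex) \<Rightarrow> (complex \<Rightarrow> complex) set" where
  "cls a z g = crit_ideal a z +>\<^bsub>regular_functions (U_set z)\<^esub> ext0 (U_set z) g"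

text \<open>
  \<open>residue F p\<close> is \<open>1/(2 \<pi> \<i>)\<close> times the integral of \<open>F\<close> over small positively oriented circles
  around \<open>p\<close>. The form on \<open>carrier (A_Phi a z)\<close> is the common value over all representatives
  \<open>g\<close> and \<open>h\<close> of the two classes.
\<close>

definition residue_form ::
  "('n \<Rightarrow> complex) \<Rightarrow> complex ^ 'n::finite \<Rightarrow> (complex \<Rightarrow> complex) set \<Rightarrow> (complex \<Rightarrow> complex) set \<Rightarrow> complex" where
  "residue_form a z X Y =
     (THE c. \<forall>g\<in>X. \<forall>h\<in>Y. c = (\<Sum>p\<in>crit a z. residue (\<lambda>t. g t * h t / dPhi a z t) p))"

text \<open>The linear map with \<open>\<partial>\<^sub>j \<mapsto> [a\<^sub>j / f\<^sub>j]\<close>.\<close>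

definition beta :: "('n \<Rightarrow> complex) \<Rightarrow> complex ^ 'n::finite \<Rightarrow> complex ^ 'n \<Rightarrow> (complex \<Rightarrow> complex) set" where
  "beta a z u = cls a z (\<lambda>t. \<Sum>j\<in>UNIV. u $ j * (a j / f_lin j z t))"

definition eta :: "('n \<Rightarrow> complex) \<Rightarrow> complex ^ 'n::finite \<Rightarrow> complex ^ 'n \<Rightarrow> complex ^ 'n \<Rightarrow> complex" where
  "eta a z u v = residue_form a z (beta a z u) (beta a z v)"

definition eta_tilde :: "('n \<Rightarrow> complex) \<Rightarrow> complex ^ 'n::finite \<Rightarrow> complex ^ 'n \<Rightarrow> (complex ^ 'n \<Rightarrow> complex)" where
  "eta_tilde a z u = (\<lambda>v. eta a z u v)"

definition tmult_offdiag :: "('n \<Rightarrow> complex) \<Rightarrow> complex ^ 'n::finite \<Rightarrow> 'n \<Rightarrow> 'n \<Rightarrow> complex ^ 'n" where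
  "tmult_offdiag a z i j =
     (a i / (z $ i - z $ j)) *s axis j 1 + (a j / (z $ j - z $ i)) *s axis i 1"

definition tmult_basis :: "('n \<Rightarrow> complex) \<Rightarrow> complex ^ 'n::finite \<Rightarrow> 'n \<Rightarrow> 'n \<Rightarrow> complex ^ 'n" where
  "tmult_basis a z i j =
     (if i \<noteq> j then tmult_offdiag a z i j else - (\<Sum>k\<in>UNIV - {i}. tmult_offdiag a z i k))"

definition tmult :: "('n \<Rightarrow> complex) \<Rightarrow> complex ^ 'n::finite \<Rightarrow> complex ^ 'n \<Rightarrow> complex ^ 'n \<Rightarrow> complex ^ 'n" where
  "tmult a z u v = (\<Sum>i\<in>UNIV. \<Sum>j\<in>UNIV. (u $ i * v $ j) *s tmult_basis a z i j)"

text \<open>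
  The multiplication induced on the image \<open>B\<^sup>*(z)\<close> of \<open>eta_tilde a z\<close>; it is meaningful only for
  arguments in that image.
\<close>

definition Bstar :: "('n \<Rightarrow> complex) \<Rightarrow> complex ^ 'n::finite \<Rightarrow> (complex ^ 'n \<Rightarrow> complex) set" where
  "Bstar a z = range (eta_tilde a z)"

definition Bmult ::
  "('n \<Rightarrow> complex) \<Rightarrow> complex ^ 'n::finite \<Rightarrow> (complex ^ 'n \<Rightarrow> complex) \<Rightarrow> (complex ^ 'n \<Rightarrow> complex)
     \<Rightarrow> (complex ^ 'n \<Rightarrow> complex)" where
  "Bmult a z \<phi> \<psi> =
     (THE \<omega>. \<omega> \<in> Bstar a z \<and>
        (\<forall>u v. eta_tilde a z u = \<phi> \<and> eta_tilde a z v = \<psi> \<longrightarrow> \<omega> = eta_tilde a z (tmult a z u v)))"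

text \<open>
  \<open>P\<close> is a single-valued branch on \<open>W\<close> of the multivalued function \<open>1/2 \<Sum>\<^sub>i\<^sub><\<^sub>j a\<^sub>i a\<^sub>j (z\<^sub>i - z\<^sub>j)\<^sup>2 log (z\<^sub>i - z\<^sub>j)\<close>,
  with the branches of the logarithms chosen independently of each other.
\<close>

definition Ptilde_branch_on ::
  "('n::{finite,linorder} \<Rightarrow> complex) \<Rightarrow> (complex, 'n) vec set \<Rightarrow> ((complex, 'n) vec \<Rightarrow> complex) \<Rightarrow> bool" where
  "Ptilde_branch_on a W P \<longleftrightarrow>
     (\<exists>L. (\<forall>i j. i < j \<longrightarrow> log_branch_on W (\<lambda>w. w $ i - w $ j) (L i j)) \<and>
          (\<forall>w\<in>W. P w = 1 / 2 * (\<Sum>(i, j) | i < j. a i * a j * (w $ i - w $ j)\<^sup>2 * L i j w)))"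

definition partial_z :: "'n \<Rightarrow> (complex ^ 'n::finite \<Rightarrow> complex) \<Rightarrow> complex ^ 'n \<Rightarrow> complex" where
  "partial_z i F z = deriv (\<lambda>s. F (z + s *s axis i 1)) 0"

lemma cls_in_A_Phi:
  assumes "ext0 (U_set z) g \<in> carrier (regular_functions (U_set z))"
  shows "cls a z g \<in> carrier (A_Phi a z)"
  using assms by (auto simp: cls_def A_Phi_def FactRing_def A_RCOSETS_def')

lemma dPhi_branch:
  assumes "open V" "t \<in> V" "V \<subseteq> U_set z"
    and L: "\<And>j. log_branch_on V (f_lin j z) (L j)"
  shows "((\<lambda>s. \<Sum>j\<in>UNIV. a j * L j s) has_field_derivative dPhi a z t) (at t)"
proof -
  have "(L j has_field_derivative 1 / f_lin j z t) (at t)" for j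
  proof -
    have nz: "f_lin j z t \<noteq> 0"
      using assms(2) L[of j] by (metis exp_not_eq_zero log_branch_on_def)
    have c: "isCont (L j) t"
      using L[of j] assms(1,2) by (auto simp: log_branch_on_def continuous_on_eq_continuous_at)
    have "(L j has_field_derivative inverse (exp (L j t))) (at t)"
    proof (rule has_field_derivative_inverse_basic)
      show "DERIV (\<lambda>w. exp w - z $ j) (L j t) :> exp (L j t)"
        by (auto intro!: derivative_eq_intros)
      show "exp (L j s) - z $ j = s" if "s \<in> V" for s
        using L[of j] that by (simp add: log_branch_on_def f_lin_def)
    qed (use c assms in auto)
    then show ?thesis
      using L[of j] assms(2) by (simp add: log_branch_on_def inverse_eq_divide)
  qed
  then show ?thesis
    unfolding dPhi_def by (auto intro!: derivative_eq_intros sum.cong)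
qed

lemma Ptilde_branch_exists:
  assumes "z \<notin> (Delta :: (complex ^ 'n::{finite,linorder}) set)"
  obtains W P where "open W" "z \<in> W" "W \<inter> Delta = {}" "Ptilde_branch_on a W P"
proof -
  define W where "W = (\<Inter>(i,j)\<in>{(i,j). i < j}. {w :: (complex,'n) vec. 0 < Re ((w $ i - w $ j) / (z $ i - z $ j))})"
  have nz: "z $ i - z $ j \<noteq> 0" if "i < j" for i j
    using assms that by (auto simp: Delta_def)
  define L where "L i j w = Ln ((w $ i - w $ j) / (z $ i - z $ j)) + Ln (z $ i - z $ j)" for i j and w :: "(complex, 'n) vec"
  have "open W" unfolding W_def
    by (intro open_INT) (auto intro!: open_Collect_less continuous_intros dest: nz)
  moreover have "z \<in> W" by (auto simp: W_def dest: nz)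
  moreover have "W \<inter> Delta = {}" by (force simp: W_def Delta_def)
  moreover have "log_branch_on W (\<lambda>w. w $ i - w $ j) (L i j)" if "i < j" for i j
  proof -
    have pos: "0 < Re ((w $ i - w $ j) / (z $ i - z $ j))" if "w \<in> W" for w
      using that \<open>i < j\<close> by (auto simp: W_def)
    have "continuous_on W (L i j)" unfolding L_def
      by (intro continuous_intros) (use pos nz[OF that] in \<open>force simp: complex_nonpos_Reals_iff\<close>)+
    moreover have "exp (L i j w) = w $ i - w $ j" if "w \<in> W" for w
    proof -
      have "(w $ i - w $ j) / (z $ i - z $ j) \<noteq> 0" using pos[OF that] by (metis less_irrefl zero_complex.sel(1))
      then show ?thesis unfolding L_def exp_add using nz[OF \<open>i < j\<close>] by (simp add: exp_Ln)
    qed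
    ultimately show ?thesis by (auto simp: log_branch_on_def)
  qed
  then have "Ptilde_branch_on a W (\<lambda>w. 1 / 2 * (\<Sum>(i, j) | i < j. a i * a j * (w $ i - w $ j)\<^sup>2 * L i j w))"
    unfolding Ptilde_branch_on_def by blast
  ultimately show ?thesis using that by blast
qed

end

theory Submission imports Defs begin

text \<open>
  Both sides of the identity are computed and compared. Write \<open>|a|\<close> for the sum of the weights and
  \<open>c\<^sub>k\<^sub>l(v) = a\<^sub>k a\<^sub>l (v\<^sub>k - v\<^sub>l) / (z\<^sub>k - z\<^sub>l)\<close>, which is symmetric in \<open>k\<close> and \<open>l\<close>. Each side, evaluated at a
  tangent vector \<open>v\<close>, turns out to be \<open>- c\<^sub>i\<^sub>j(v)\<close> for \<open>i \<noteq> j\<close>, and the sum of the \<open>c\<^sub>i\<^sub>l(v)\<close> over \<open>l\<close> for \<open>i = j\<close>.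

  The algebraic side needs the bilinear form in closed form,
  \<open>\<eta>(u,v) = (\<Sum> a\<^sub>k u\<^sub>k)(\<Sum> a\<^sub>k v\<^sub>k) / |a| - \<Sum> a\<^sub>k u\<^sub>k v\<^sub>k\<close> (lemma \<open>eta_eq\<close>). Put \<open>g = \<Sum> a\<^sub>k u\<^sub>k / (z\<^sub>k + t)\<close> and
  \<open>h = \<Sum> a\<^sub>k v\<^sub>k / (z\<^sub>k + t)\<close>. The rational function \<open>g h / (\<partial>\<Phi>/\<partial>t)\<close> is holomorphic except at the critical points of
  \<open>\<Phi>\<close> and at the points \<open>-z\<^sub>k\<close>. Its residues at all these points add up to its
  coefficient of \<open>1/t\<close> at infinity (lemma \<open>sum_residues_eq_limit_at_infinity\<close>), and this coefficient is the
  first term of the formula; the residue at \<open>-z\<^sub>k\<close> is \<open>a\<^sub>k u\<^sub>k v\<^sub>k\<close>. The residues at the critical points, whose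
  sum is \<open>\<eta>(u,v)\<close>, therefore contribute the difference, whatever the multiplicities of these points.
  That the form is well defined on classes rests on the critical ideal being principal: changing a
  representative changes \<open>g h / (\<partial>\<Phi>/\<partial>t)\<close> by a function regular at the critical points (lemma
  \<open>residue_form_cls\<close>).

  The formula shows that the kernel of \<open>\<eta>\<close> consists of the vectors with equal coordinates. These multiply everything to
  zero, so the product on covectors is well defined (lemma \<open>Bmult_eta_tilde\<close>), and the right-hand side is
  \<open>-\<eta>(\<partial>\<^sub>i * \<partial>\<^sub>j, v)\<close>. Since \<open>\<Sum> a\<^sub>m u\<^sub>m = 0\<close> for \<open>u = \<partial>\<^sub>i * \<partial>\<^sub>j\<close>, only the diagonal part of \<open>\<eta>\<close> remains (lemma
  \<open>eta_tmult_basis\<close>).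

  On the analytic side, every continuous branch of a logarithm of \<open>g\<close> is, near a point \<open>w\<close>, a constant plus
  the principal logarithm of \<open>g / g(w)\<close>, so it has the usual derivative, and the third derivative of \<open>x\<^sup>2 log x / 2\<close> is \<open>1/x\<close>: the ambiguity of the
  branches has disappeared (lemma \<open>prepotential_second_partials_has_derivative\<close>).
\<close>

\<comment> \<open>From here on \<open>$\<close> denotes only the coordinates of a vector.\<close>
no_notation fps_nth (infixl "$" 75)

section \<open>The residue theorem at infinity\<close>

text \<open>
  On a circle of large radius \<open>R\<close> around \<open>0\<close> that encloses \<open>S\<close>, the integral of \<open>F\<close> is \<open>2 \<pi> \<i>\<close> times the sum of
  residues and that of \<open>c / t\<close> is \<open>2 \<pi> \<i> c\<close>. By hypothesis the integrands differ by at most \<open>e / R\<close> for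
  large \<open>R\<close>, so the integrals differ by at most \<open>2 \<pi> e\<close>, for every \<open>e > 0\<close>.
\<close>

lemma sum_residues_eq_limit_at_infinity:
  fixes F :: "complex \<Rightarrow> complex"
  assumes S: "finite S" and holo: "F holomorphic_on UNIV - S"
    and lim: "((\<lambda>t. t * F t) \<longlongrightarrow> c) at_infinity"
  shows "(\<Sum>p\<in>S. residue F p) = c"
proof -
  let ?s = "\<Sum>p\<in>S. residue F p"
  have close: "norm (?s - c) \<le> e" if "e > 0" for e
  proof -
    obtain b where b: "\<And>t. b \<le> norm t \<Longrightarrow> dist (t * F t) c < e"
      using tendstoD[OF lim \<open>e > 0\<close>] by (auto simp: eventually_at_infinity)
    obtain B where B: "\<And>p. p \<in> S \<Longrightarrow> norm p \<le> B"
      using finite_imp_bounded[OF S] by (auto simp: bounded_iff)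
    define R where "R = max 1 (max b (B + 1))"
    have R: "R > 0" "b \<le> R" "\<And>p. p \<in> S \<Longrightarrow> norm p < R"
      using B by (force simp: R_def)+
    have avoid: "path_image (circlepath 0 R) \<subseteq> UNIV - S"
      using R(1,3) by fastforce
    have cont: "F contour_integrable_on circlepath 0 R"
      using holomorphic_on_imp_continuous_on[OF holo] avoid
      by (intro contour_integrable_continuous_circlepath) (rule continuous_on_subset)
    have "contour_integral (circlepath 0 R) F =
            2 * pi * \<i> * (\<Sum>p\<in>S. winding_number (circlepath 0 R) p * residue F p)"
      using avoid S holo by (intro Residue_theorem[of UNIV]) auto
    also have "(\<Sum>p\<in>S. winding_number (circlepath 0 R) p * residue F p) = ?s"
      using R(3) by (intro sum.cong) (auto simp: winding_number_circlepath)
    finally have "(F has_contour_integral 2 * pi * \<i> * ?s) (circlepath 0 R)"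
      using has_contour_integral_integral[OF cont] by simp
    moreover have "((\<lambda>t. c / (t - 0)) has_contour_integral (2 * pi * \<i> * c)) (circlepath 0 R)"
      using Cauchy_integral_circlepath_simple[of "\<lambda>_. c" 0 R 0] R(1) by simp
    ultimately have "((\<lambda>t. F t - c / (t - 0)) has_contour_integral
        (2 * pi * \<i> * ?s - 2 * pi * \<i> * c)) (circlepath 0 R)"
      by (rule has_contour_integral_diff)
    moreover have "norm (F t - c / (t - 0)) \<le> e / R" if "norm (t - 0) = R" for t
    proof -
      have "t \<noteq> 0" using that R(1) by auto
      then have "F t - c / (t - 0) = (t * F t - c) / t"
        by (simp add: field_simps)
      then show ?thesis
        using b[of t] that R(1,2) by (simp add: norm_divide dist_norm divide_right_mono)
    qed
    ultimately have "norm (2 * pi * \<i> * ?s - 2 * pi * \<i> * c) \<le> e / R * (2 * pi * R)"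
      using R(1) \<open>e > 0\<close> by (intro has_contour_integral_bound_circlepath) auto
    moreover have "2 * pi * \<i> * ?s - 2 * pi * \<i> * c = 2 * pi * \<i> * (?s - c)"
      by (simp add: algebra_simps)
    ultimately show ?thesis
      using R(1) by (simp add: norm_mult)
  qed
  have "norm (?s - c) \<le> 0"
    by (rule field_le_epsilon) (use close in simp)
  then show ?thesis by simp
qed

section \<open>Sums of simple fractions\<close>

text \<open>
  The function \<open>dPhi c z\<close> is the partial fraction with coefficients \<open>c\<close> at the poles \<open>-z\<^sub>j\<close>. It
  occurs below not only for the weights \<open>c = a\<close>: the representative of \<open>beta a z u\<close> is
  \<open>dPhi c z\<close> with \<open>c\<^sub>j = a\<^sub>j u\<^sub>j\<close>. Hence the coefficients are arbitrary in this section.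
\<close>

lemma open_U_set: "open (U_set z)" and compl_U_set: "- U_set z = range (\<lambda>j. - (z $ j))"
  by (auto simp: U_set_def intro!: finite_imp_closed)

lemma dPhi_holomorphic: "dPhi c z holomorphic_on U_set z"
proof -
  have "z $ j + t \<noteq> 0" if "t \<in> U_set z" for t j
    using that by (auto simp: U_set_def add_eq_0_iff)
  then show ?thesis
    unfolding dPhi_def[abs_def] f_lin_def by (intro holomorphic_intros) auto
qed

lemma dPhi_at_infinity: "((\<lambda>t. t * dPhi c z t) \<longlongrightarrow> (\<Sum>j\<in>UNIV. c j)) at_infinity"
proof -
  have "((\<lambda>t. t * (c j / (z $ j + t))) \<longlongrightarrow> c j) at_infinity" for j
  proof -
    have lin: "filterlim (\<lambda>t. z $ j + t) at_infinity at_infinity"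
      by (intro tendsto_add_filterlim_at_infinity[OF tendsto_const] filterlim_ident)
    have "((\<lambda>t. c j - c j * z $ j / (z $ j + t)) \<longlongrightarrow> c j - 0) at_infinity"
      by (intro tendsto_intros tendsto_divide_0[OF tendsto_const lin])
    moreover have "\<forall>\<^sub>F t in at_infinity. t * (c j / (z $ j + t)) = c j - c j * z $ j / (z $ j + t)"
      using filterlim_at_infinity_imp_eventually_ne[OF lin, of 0]
      by eventually_elim (simp add: field_simps)
    ultimately show ?thesis by (simp add: filterlim_cong)
  qed
  then show ?thesis
    unfolding dPhi_def f_lin_def sum_distrib_left by (intro tendsto_sum)
qed

lemma dPhi_at_pole:
  assumes "inj (($) z)"
  shows "((\<lambda>t. (t + z $ k) * dPhi c z t) \<longlongrightarrow> c k) (at (- (z $ k)))"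
proof -
  have "((\<lambda>t. (t + z $ k) * (c j / (z $ j + t))) \<longlongrightarrow> (if j = k then c j else 0)) (at (- (z $ k)))" for j
  proof (cases "j = k")
    case True
    have "\<forall>\<^sub>F t in at (- (z $ k)). (t + z $ k) * (c j / (z $ j + t)) = c j"
      using eventually_neq_at_within[of "- (z $ k)" "- (z $ k)" UNIV]
    proof eventually_elim
      case (elim t)
      then have "z $ k + t \<noteq> 0" by (simp add: add_eq_0_iff)
      then show ?case using True by (simp add: add.commute)
    qed
    then show ?thesis using True by (simp add: tendsto_eventually)
  next
    case False
    then have "z $ j \<noteq> z $ k" using assms by (auto dest: injD)
    then have "((\<lambda>t. (t + z $ k) * (c j / (z $ j + t))) \<longlongrightarrow>
        (- (z $ k) + z $ k) * (c j / (z $ j + - (z $ k)))) (at (- (z $ k)))"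
      by (intro tendsto_intros) auto
    then show ?thesis using False by simp
  qed
  then have "((\<lambda>t. (t + z $ k) * dPhi c z t) \<longlongrightarrow> (\<Sum>j\<in>UNIV. if j = k then c j else 0)) (at (- (z $ k)))"
    unfolding dPhi_def f_lin_def sum_distrib_left by (intro tendsto_sum)
  then show ?thesis by simp
qed

lemma dPhi_rational:
  fixes z :: "complex ^ 'n::finite"
  shows "\<exists>p q. \<forall>t\<in>U_set z. poly q t \<noteq> 0 \<and> dPhi c z t = poly p t / poly q t"
proof (intro exI ballI conjI)
  let ?q = "\<Prod>j\<in>UNIV. [:z $ j, 1:]"
  let ?p = "\<Sum>j\<in>UNIV. smult (c j) (\<Prod>k\<in>UNIV-{j}. [:z $ k, 1:])"
  fix t assume t: "t \<in> U_set z"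
  show nz: "poly ?q t \<noteq> 0"
    using t by (auto simp: poly_prod U_set_def add_eq_0_iff)
  show "dPhi c z t = poly ?p t / poly ?q t"
  proof -
    have "c j / (z $ j + t) = c j * (\<Prod>k\<in>UNIV-{j}. z $ k + t) / (\<Prod>k\<in>UNIV. z $ k + t)" for j
      using nz by (subst (2) prod.remove[of _ j]) (auto simp: poly_prod)
    then show ?thesis
      by (simp add: dPhi_def f_lin_def poly_prod poly_sum sum_divide_distrib)
  qed
qed

text \<open>
  The zeros are roots of the numerator, a polynomial. It is not the zero polynomial, since
  \<open>t * dPhi c z t\<close> has a nonzero limit at infinity.
\<close>

lemma finite_zeros_dPhi:
  assumes "(\<Sum>j\<in>UNIV. c j) \<noteq> 0"
  shows "finite {t \<in> U_set z. dPhi c z t = 0}"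
proof -
  obtain p q where pq: "\<forall>t\<in>U_set z. poly q t \<noteq> 0 \<and> dPhi c z t = poly p t / poly q t"
    using dPhi_rational[of z c] by blast
  have "p \<noteq> 0"
  proof
    assume "p = 0"
    have "finite (- U_set z)" by (simp add: compl_U_set)
    moreover have "\<forall>\<^sub>F t in at_infinity. t \<noteq> s" for s :: complex
      using filterlim_at_infinity_imp_eventually_ne[OF filterlim_ident] .
    ultimately have "\<forall>\<^sub>F t in at_infinity. \<forall>s\<in>- U_set z. t \<noteq> s"
      by (intro eventually_ball_finite) auto
    then have "\<forall>\<^sub>F t in at_infinity. t * dPhi c z t = 0"
      by eventually_elim (use pq \<open>p = 0\<close> in auto)
    then have "((\<lambda>t. t * dPhi c z t) \<longlongrightarrow> 0) at_infinity"
      by (rule tendsto_eventually)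
    then show False
      using tendsto_unique[OF trivial_limit_at_infinity dPhi_at_infinity[of c z]] assms by blast
  qed
  then have "finite {t. poly p t = 0}" by (rule poly_roots_finite)
  then show ?thesis by (rule rev_finite_subset) (use pq in auto)
qed

section \<open>The residue form\<close>

lemma regular_functions_ops:
  "x \<otimes>\<^bsub>regular_functions V\<^esub> y = (\<lambda>t. x t * y t)"
  "x \<oplus>\<^bsub>regular_functions V\<^esub> y = (\<lambda>t. x t + y t)"
  "\<one>\<^bsub>regular_functions V\<^esub> = ext0 V (\<lambda>t. 1)"
  "\<zero>\<^bsub>regular_functions V\<^esub> = (\<lambda>t. 0)"
  by (simp_all add: regular_functions_def)

lemma mem_regular_functions_iff:
  "g \<in> carrier (regular_functions V) \<longleftrightarrow>
     (\<exists>p q. (\<forall>t\<in>V. poly q t \<noteq> 0) \<and> g = ext0 V (\<lambda>t. poly p t / poly q t))"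
  by (auto simp: regular_functions_def)

text \<open>
  The critical ideal is an intersection of ideals; in a commutative ring an ideal generated by one element
  consists of its multiples. The ring axioms hold pointwise, so closure is what needs the quotients of
  polynomials; the values \<open>0\<close> outside \<open>V\<close> make the extension of \<open>1\<close> a neutral element.
\<close>

lemma cring_regular_functions: "cring (regular_functions V)"
proof -
  let ?R = "regular_functions V"
  have closed: "(\<lambda>t. g t * h t) \<in> carrier ?R \<and> (\<lambda>t. g t + h t) \<in> carrier ?R"
    if gR: "g \<in> carrier ?R" and hR: "h \<in> carrier ?R" for g h
  proof -
    obtain p q where g: "g = ext0 V (\<lambda>t. poly p t / poly q t)" "\<forall>t\<in>V. poly q t \<noteq> 0"
      using gR unfolding mem_regular_functions_iff by blast
    obtain p' q' where h: "h = ext0 V (\<lambda>t. poly p' t / poly q' t)" "\<forall>t\<in>V. poly q' t \<noteq> 0"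
      using hR unfolding mem_regular_functions_iff by blast
    have "(\<lambda>t. g t * h t) = ext0 V (\<lambda>t. poly (p * p') t / poly (q * q') t)"
      by (auto simp: g h ext0_def)
    moreover have "(\<lambda>t. g t + h t) = ext0 V (\<lambda>t. poly (p * q' + p' * q) t / poly (q * q') t)"
    proof
      fix t
      show "g t + h t = ext0 V (\<lambda>t. poly (p * q' + p' * q) t / poly (q * q') t) t"
      proof (cases "t \<in> V")
        case True
        then have "poly q t \<noteq> 0" "poly q' t \<noteq> 0" using g(2) h(2) by auto
        then show ?thesis
          unfolding g(1) h(1) ext0_def if_P[OF True] poly_add poly_mult by (rule add_frac_eq)
      qed (simp add: g(1) h(1) ext0_def)
    qed
    moreover have "\<forall>t\<in>V. poly (q * q') t \<noteq> 0" using g h by simp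
    ultimately show ?thesis
      unfolding mem_regular_functions_iff by blast
  qed
  have const: "ext0 V (\<lambda>t. c) \<in> carrier ?R" for c
    unfolding mem_regular_functions_iff by (intro exI[of _ "[:c:]"] exI[of _ 1]) simp
  have zero: "(\<lambda>t. 0) \<in> carrier ?R"
    using const[of 0] by (simp add: ext0_def[abs_def])
  have ext: "g t = 0" if "g \<in> carrier ?R" "t \<notin> V" for g t
    using that by (auto simp: regular_functions_def ext0_def)
  have one: "(\<lambda>t. ext0 V (\<lambda>t. 1) t * g t) = g" if "g \<in> carrier ?R" for g
    using ext[OF that] by (auto simp: ext0_def fun_eq_iff)
  have neg: "\<exists>h\<in>carrier ?R. (\<lambda>t. h t + g t) = (\<lambda>t. 0)" if "g \<in> carrier ?R" for g
  proof
    show "(\<lambda>t. ext0 V (\<lambda>t. -1) t * g t) \<in> carrier ?R"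
      using closed[OF const that] by blast
    show "(\<lambda>t. ext0 V (\<lambda>t. -1) t * g t + g t) = (\<lambda>t. 0)"
      using ext[OF that] by (auto simp: ext0_def fun_eq_iff)
  qed
  show ?thesis
    by (intro cringI abelian_groupI comm_monoidI; unfold regular_functions_ops;
        ((rule conjunct1[OF closed] conjunct2[OF closed]; assumption) | rule const zero |
         erule one neg | simp add: algebra_simps))
qed

lemma regular_functions_holomorphic:
  assumes "g \<in> carrier (regular_functions V)"
  shows "g holomorphic_on V"
proof -
  obtain p q where g: "g = ext0 V (\<lambda>t. poly p t / poly q t)" "\<forall>t\<in>V. poly q t \<noteq> 0"
    using assms unfolding mem_regular_functions_iff by blast
  have "(\<lambda>t. poly p t / poly q t) holomorphic_on V"
    using g(2) by (intro holomorphic_intros) auto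
  then show ?thesis
    by (rule holomorphic_transform) (simp add: g ext0_def)
qed

lemma ext0_dPhi_regular: "ext0 (U_set z) (dPhi c z) \<in> carrier (regular_functions (U_set z))"
proof -
  obtain p q where "\<forall>t\<in>U_set z. poly q t \<noteq> 0 \<and> dPhi c z t = poly p t / poly q t"
    using dPhi_rational[of z c] by blast
  then have "ext0 (U_set z) (dPhi c z) = ext0 (U_set z) (\<lambda>t. poly p t / poly q t)"
      "\<forall>t\<in>U_set z. poly q t \<noteq> 0"
    by (auto simp: ext0_def)
  then show ?thesis unfolding mem_regular_functions_iff by blast
qed

lemma crit_ideal_eq:
  "crit_ideal a z =
     {\<lambda>t. r t * ext0 (U_set z) (dPhi a z) t | r. r \<in> carrier (regular_functions (U_set z))}"
  unfolding crit_ideal_def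
    cring.cgenideal_eq_genideal[OF cring_regular_functions ext0_dPhi_regular, symmetric]
    cgenideal_def regular_functions_ops ..

lemma mem_cls_iff:
  "g \<in> cls a z g0 \<longleftrightarrow> (\<exists>r\<in>carrier (regular_functions (U_set z)).
     g = (\<lambda>t. r t * ext0 (U_set z) (dPhi a z) t + ext0 (U_set z) g0 t))"
  unfolding cls_def crit_ideal_eq a_r_coset_def' regular_functions_ops by auto

text \<open>
  If \<open>g = r d + g0\<close> and \<open>h = s d + h0\<close> with \<open>d = \<partial>\<Phi>/\<partial>t\<close>, then \<open>g h / d = (r s d + r h0 + g0 s) + g0 h0 / d\<close>
  wherever \<open>d\<close> does not vanish. The bracket is holomorphic at each critical point and has no residue there,
  so the residues can be computed from any representatives of the two classes.
\<close>

lemma residue_form_cls: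
  assumes a: "(\<Sum>j\<in>UNIV. a j) \<noteq> 0"
    and g0: "g0 holomorphic_on U_set z" and h0: "h0 holomorphic_on U_set z"
  shows "residue_form a z (cls a z g0) (cls a z h0) =
           (\<Sum>p\<in>crit a z. residue (\<lambda>t. g0 t * h0 t / dPhi a z t) p)"
proof -
  let ?U = "U_set z" and ?R = "regular_functions (U_set z)"
  have indep: "residue (\<lambda>t. g t * h t / dPhi a z t) p = residue (\<lambda>t. g0 t * h0 t / dPhi a z t) p"
    if g: "g \<in> cls a z g0" and h: "h \<in> cls a z h0" and p: "p \<in> crit a z" for g h p
  proof -
    obtain r where r: "r \<in> carrier ?R" "g = (\<lambda>t. r t * ext0 ?U (dPhi a z) t + ext0 ?U g0 t)"
      using g by (auto simp: mem_cls_iff)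
    obtain s where s: "s \<in> carrier ?R" "h = (\<lambda>t. s t * ext0 ?U (dPhi a z) t + ext0 ?U h0 t)"
      using h by (auto simp: mem_cls_iff)
    let ?e = "\<lambda>t. r t * s t * dPhi a z t + r t * h0 t + g0 t * s t"
    \<comment> \<open>A neighbourhood of \<open>p\<close> that contains no other zero of \<open>d\<close>; it exists as the zeros are finitely many.\<close>
    define V where "V = ?U - (crit a z - {p})"
    have fin: "finite (crit a z)"
      unfolding crit_def by (rule finite_zeros_dPhi[OF a])
    have V: "open V" "p \<in> V" "V \<subseteq> ?U"
      using p fin by (auto simp: V_def crit_def intro!: open_Diff open_U_set finite_imp_closed)
    have nz: "dPhi a z t \<noteq> 0" if "t \<in> V - {p}" for t
      using that by (auto simp: V_def crit_def)
    have e: "?e holomorphic_on ?U"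
      by (intro holomorphic_intros dPhi_holomorphic g0 h0
            regular_functions_holomorphic[OF r(1)] regular_functions_holomorphic[OF s(1)])
    have q: "(\<lambda>t. g0 t * h0 t / dPhi a z t) holomorphic_on V - {p}"
      using V(3) nz
      by (intro holomorphic_intros holomorphic_on_subset[OF dPhi_holomorphic]
           holomorphic_on_subset[OF g0] holomorphic_on_subset[OF h0]) auto
    have "\<forall>\<^sub>F t in at p. t \<in> V - {p}"
      using V(1,2) by (rule eventually_at_in_open)
    then have "\<forall>\<^sub>F t in at p. g t * h t / dPhi a z t = ?e t + g0 t * h0 t / dPhi a z t"
    proof eventually_elim
      case (elim t)
      then have "t \<in> ?U" using V(3) by auto
      then show ?case using nz[OF elim] by (simp add: r s ext0_def field_simps)
    qed
    then have "residue (\<lambda>t. g t * h t / dPhi a z t) p =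
        residue (\<lambda>t. ?e t + g0 t * h0 t / dPhi a z t) p"
      by (rule residue_cong) simp
    also have "\<dots> = residue ?e p + residue (\<lambda>t. g0 t * h0 t / dPhi a z t) p"
      using V e q by (intro residue_add[OF V(1,2)]) (auto elim: holomorphic_on_subset)
    also have "residue ?e p = 0"
      using V e by (intro residue_holo[OF V(1,2)]) (auto elim: holomorphic_on_subset)
    finally show ?thesis by simp
  qed
  have ne: "ext0 ?U k \<in> cls a z k" for k
    using ring.ring_simprules(2)[OF cring.axioms(1)[OF cring_regular_functions], of ?U]
    unfolding mem_cls_iff regular_functions_ops by (intro bexI[of _ "\<lambda>t. 0"]) auto
  show ?thesis
    unfolding residue_form_def
  proof (rule the_equality)
    let ?c = "\<Sum>p\<in>crit a z. residue (\<lambda>t. g0 t * h0 t / dPhi a z t) p"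
    show all: "\<forall>g\<in>cls a z g0. \<forall>h\<in>cls a z h0.
        ?c = (\<Sum>p\<in>crit a z. residue (\<lambda>t. g t * h t / dPhi a z t) p)"
      by (intro ballI sum.cong refl) (rule indep[symmetric])
    show "c = ?c" if "\<forall>g\<in>cls a z g0. \<forall>h\<in>cls a z h0.
        c = (\<Sum>p\<in>crit a z. residue (\<lambda>t. g t * h t / dPhi a z t) p)" for c
      using bspec[OF bspec[OF that ne] ne] bspec[OF bspec[OF all ne] ne] by (rule trans[OF _ sym])
  qed
qed

text \<open>
  The sum over the critical points is the total residue, read off at infinity, minus the residues at the
  points \<open>-z\<^sub>k\<close>. At such a point \<open>g\<close>, \<open>h\<close> and \<open>\<partial>\<Phi>/\<partial>t\<close> have at most simple poles, with residues \<open>a\<^sub>k u\<^sub>k\<close>,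
  \<open>a\<^sub>k v\<^sub>k\<close> and \<open>a\<^sub>k \<noteq> 0\<close>, so \<open>g h / (\<partial>\<Phi>/\<partial>t)\<close> has at most a simple pole, with residue \<open>a\<^sub>k u\<^sub>k v\<^sub>k\<close>. This uses that the
  coordinates of \<open>z\<close> are distinct.
\<close>

lemma eta_eq:
  fixes z :: "complex ^ 'n::finite"
  assumes a: "\<And>k. a k \<noteq> 0" "(\<Sum>j\<in>UNIV. a j) \<noteq> 0" and inj: "inj (($) z)"
  shows "eta a z u v = (\<Sum>k\<in>UNIV. a k * u $ k) * (\<Sum>k\<in>UNIV. a k * v $ k) / (\<Sum>k\<in>UNIV. a k)
           - (\<Sum>k\<in>UNIV. a k * u $ k * v $ k)"
proof -
  let ?g = "dPhi (\<lambda>k. a k * u $ k) z" and ?h = "dPhi (\<lambda>k. a k * v $ k) z"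
  define F where "F t = ?g t * ?h t / dPhi a z t" for t
  have beta: "beta a z w = cls a z (dPhi (\<lambda>k. a k * w $ k) z)" for w
    unfolding beta_def dPhi_def[abs_def] by (simp add: mult.commute)
  have eta: "eta a z u v = (\<Sum>p\<in>crit a z. residue F p)"
    unfolding eta_def beta F_def[abs_def]
    by (intro residue_form_cls a dPhi_holomorphic)
  have fin: "finite (crit a z)"
    unfolding crit_def by (rule finite_zeros_dPhi[OF a(2)])
  have hol: "F holomorphic_on U_set z - crit a z"
    unfolding F_def[abs_def]
    by (intro holomorphic_intros holomorphic_on_subset[OF dPhi_holomorphic]) (auto simp: crit_def)
  have pole: "residue F (- (z $ k)) = a k * u $ k * v $ k" for k
  proof -
    let ?p = "- (z $ k)"
    let ?V = "UNIV - (crit a z \<union> (range (\<lambda>j. - (z $ j)) - {?p}))"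
    have "((\<lambda>t. ((t + z $ k) * ?g t) * ((t + z $ k) * ?h t) / ((t + z $ k) * dPhi a z t))
        \<longlongrightarrow> (a k * u $ k) * (a k * v $ k) / a k) (at ?p)"
      by (intro tendsto_intros dPhi_at_pole inj a)
    moreover have "\<forall>\<^sub>F t in at ?p. ((t + z $ k) * ?g t) * ((t + z $ k) * ?h t) / ((t + z $ k) * dPhi a z t)
        = F t * (t - ?p)"
      using eventually_neq_at_within[of ?p ?p UNIV]
    proof eventually_elim
      case (elim t)
      then have "t + z $ k \<noteq> 0" by (simp add: add_eq_0_iff2)
      moreover have "(x * g) * (x * h) / (x * d) = g * h / d * x" if "x \<noteq> 0" for x g h d :: complex
        using that by (cases "d = 0") (simp_all add: field_simps)
      ultimately show ?case by (simp add: F_def)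
    qed
    ultimately have "((\<lambda>t. F t * (t - ?p)) \<longlongrightarrow> (a k * u $ k) * (a k * v $ k) / a k) (at ?p)"
      by (rule Lim_transform_eventually)
    moreover have "(a k * u $ k) * (a k * v $ k) / a k = a k * u $ k * v $ k"
      using a(1)[of k] by simp
    ultimately have lim: "((\<lambda>t. F t * (t - ?p)) \<longlongrightarrow> a k * u $ k * v $ k) (at ?p)"
      by (simp only:)
    show ?thesis
    proof (rule residue_simple'[OF _ _ _ lim])
      show "open ?V" using fin by (intro open_Diff finite_imp_closed) auto
      show "?p \<in> ?V" by (auto simp: crit_def U_set_def)
      show "F holomorphic_on ?V - {?p}"
        by (rule holomorphic_on_subset[OF hol]) (auto simp: U_set_def)
    qed
  qed
  let ?c = "(\<Sum>k\<in>UNIV. a k * u $ k) * (\<Sum>k\<in>UNIV. a k * v $ k) / (\<Sum>k\<in>UNIV. a k)"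
  have "((\<lambda>t. (t * ?g t) * (t * ?h t) / (t * dPhi a z t)) \<longlongrightarrow> ?c) at_infinity"
    by (intro tendsto_intros dPhi_at_infinity a)
  moreover have "\<forall>\<^sub>F t in at_infinity. (t * ?g t) * (t * ?h t) / (t * dPhi a z t) = t * F t"
    using filterlim_at_infinity_imp_eventually_ne[OF filterlim_ident, of 0]
    by eventually_elim (simp add: F_def field_simps)
  ultimately have lim: "((\<lambda>t. t * F t) \<longlongrightarrow> ?c) at_infinity"
    by (rule Lim_transform_eventually)
  have total: "?c = (\<Sum>p\<in>crit a z \<union> range (\<lambda>k. - (z $ k)). residue F p)"
    using fin hol
    by (intro sum_residues_eq_limit_at_infinity[OF _ _ lim, symmetric])
      (auto simp: U_set_def elim: holomorphic_on_subset)
  have split: "(\<Sum>p\<in>crit a z \<union> range (\<lambda>k. - (z $ k)). residue F p) =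
      (\<Sum>p\<in>crit a z. residue F p) + (\<Sum>p\<in>range (\<lambda>k. - (z $ k)). residue F p)"
    using fin by (intro sum.union_disjoint) (auto simp: crit_def U_set_def)
  have poles: "(\<Sum>p\<in>range (\<lambda>k. - (z $ k)). residue F p) = (\<Sum>k\<in>UNIV. a k * u $ k * v $ k)"
    using inj by (subst sum.reindex) (auto simp: pole inj_def)
  show ?thesis
    unfolding eta total split poles by (rule add_diff_cancel_right'[symmetric])
qed

section \<open>The multiplication on covectors\<close>

text \<open>
  The diagonal products are defined so that the sum of all \<open>\<partial>\<^sub>j\<close> annihilates everything. This is the
  property that makes the product of covectors independent of the chosen preimages.
\<close>

lemma tmult_offdiag_sym: "tmult_offdiag a z i j = tmult_offdiag a z j i"
  by (simp add: tmult_offdiag_def add.commute)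

lemma tmult_basis_sym: "tmult_basis a z i j = tmult_basis a z j i"
  by (simp add: tmult_basis_def tmult_offdiag_sym)

lemma tmult_sym: "tmult a z u v = tmult a z v u"
  unfolding tmult_def
  by (subst sum.swap) (simp add: tmult_basis_sym mult.commute)

lemma sum_tmult_basis: "(\<Sum>j\<in>UNIV. tmult_basis a z i j) = 0"
proof -
  have "(\<Sum>j\<in>UNIV. tmult_basis a z i j) = tmult_basis a z i i + (\<Sum>j\<in>UNIV-{i}. tmult_basis a z i j)"
    by (intro sum.remove) auto
  also have "(\<Sum>j\<in>UNIV-{i}. tmult_basis a z i j) = (\<Sum>j\<in>UNIV-{i}. tmult_offdiag a z i j)"
    by (intro sum.cong) (auto simp: tmult_basis_def)
  finally show ?thesis by (simp add: tmult_basis_def)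
qed

lemma tmult_add_const: "tmult a z u (\<chi> k. v $ k + s) = tmult a z u v"
proof -
  have "tmult a z u (\<chi> k. v $ k + s) =
      tmult a z u v + (\<Sum>i\<in>UNIV. (u $ i * s) *s (\<Sum>j\<in>UNIV. tmult_basis a z i j))"
    by (simp add: tmult_def vec_eq_iff sum_component algebra_simps sum.distrib sum_distrib_left)
  then show ?thesis by (simp add: sum_tmult_basis)
qed

lemma tmult_axis:
  fixes z :: "complex ^ 'n::finite"
  shows "tmult a z (axis i 1) (axis j 1) = tmult_basis a z i j"
proof -
  have "(axis i 1 $ k * axis j 1 $ l) *s x = (if l = j then if k = i then x else 0 else 0)"
    for k l and x :: "complex ^ 'n"
    by (auto simp: axis_def)
  then show ?thesis by (simp add: tmult_def)
qed

text \<open>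
  Evaluated at \<open>\<partial>\<^sub>k\<close>, the covector of \<open>u\<close> is \<open>a\<^sub>k (m - u\<^sub>k)\<close>, where \<open>m\<close> is the weighted mean of the coordinates
  of \<open>u\<close>. As \<open>a\<^sub>k \<noteq> 0\<close>, the covector determines \<open>u\<close> up to the shift by the difference of the means.
\<close>

lemma eta_tilde_eq_imp:
  fixes z :: "complex ^ 'n::finite"
  assumes a: "\<And>k. a k \<noteq> 0" "(\<Sum>j\<in>UNIV. a j) \<noteq> 0" and inj: "inj (($) z)"
    and eq: "eta_tilde a z u = eta_tilde a z v"
  obtains s where "u = (\<chi> k. v $ k + s)"
proof
  let ?m = "\<lambda>w :: complex ^ 'n. (\<Sum>k\<in>UNIV. a k * w $ k) / (\<Sum>k\<in>UNIV. a k)"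
  have "?m u - u $ k = ?m v - v $ k" for k
  proof -
    have ax: "(\<Sum>l\<in>UNIV. c l * axis k 1 $ l) = c k" for c :: "'n \<Rightarrow> complex"
    proof -
      have "(\<Sum>l\<in>UNIV. c l * axis k 1 $ l) = (\<Sum>l\<in>UNIV. if l = k then c l else 0)"
        by (intro sum.cong) (auto simp: axis_def)
      then show ?thesis by simp
    qed
    have "eta a z w (axis k 1) = a k * (?m w - w $ k)" for w
      unfolding eta_eq[OF a inj] ax by (simp add: algebra_simps)
    moreover have "eta a z u (axis k 1) = eta a z v (axis k 1)"
      using fun_cong[OF eq] by (simp add: eta_tilde_def)
    ultimately have "a k * (?m u - u $ k) = a k * (?m v - v $ k)"
      by simp
    then show ?thesis using a(1)[of k] by simp
  qed
  then show "u = (\<chi> k. v $ k + (?m u - ?m v))"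
    by (simp add: vec_eq_iff algebra_simps)
qed

lemma tmult_eta_tilde_cong:
  fixes z :: "complex ^ 'n::finite"
  assumes a: "\<And>k. a k \<noteq> 0" "(\<Sum>j\<in>UNIV. a j) \<noteq> 0" and inj: "inj (($) z)"
    and u: "eta_tilde a z u' = eta_tilde a z u" and v: "eta_tilde a z v' = eta_tilde a z v"
  shows "tmult a z u' v' = tmult a z u v"
proof -
  obtain s where s: "u' = (\<chi> k. u $ k + s)"
    using eta_tilde_eq_imp[OF a inj u] by blast
  obtain s' where s': "v' = (\<chi> k. v $ k + s')"
    using eta_tilde_eq_imp[OF a inj v] by blast
  have "tmult a z u' v' = tmult a z u' v"
    unfolding s' by (rule tmult_add_const)
  also have "\<dots> = tmult a z v u'"
    by (rule tmult_sym)
  also have "\<dots> = tmult a z v u"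
    unfolding s by (rule tmult_add_const)
  also have "\<dots> = tmult a z u v"
    by (rule tmult_sym)
  finally show ?thesis .
qed

lemma Bmult_eta_tilde:
  fixes z :: "complex ^ 'n::finite"
  assumes a: "\<And>k. a k \<noteq> 0" "(\<Sum>j\<in>UNIV. a j) \<noteq> 0" and inj: "inj (($) z)"
  shows "Bmult a z (eta_tilde a z u) (eta_tilde a z v) = eta_tilde a z (tmult a z u v)"
  unfolding Bmult_def
proof (intro the_equality conjI allI impI)
  show "eta_tilde a z (tmult a z u v) \<in> Bstar a z"
    unfolding Bstar_def by (rule rangeI)
next
  fix u' v'
  assume "eta_tilde a z u' = eta_tilde a z u \<and> eta_tilde a z v' = eta_tilde a z v"
  then show "eta_tilde a z (tmult a z u v) = eta_tilde a z (tmult a z u' v')"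
    using tmult_eta_tilde_cong[OF a inj, of u' u v' v] by (simp only:)
next
  fix \<omega>
  assume "\<omega> \<in> Bstar a z \<and> (\<forall>u' v'. eta_tilde a z u' = eta_tilde a z u \<and>
      eta_tilde a z v' = eta_tilde a z v \<longrightarrow> \<omega> = eta_tilde a z (tmult a z u' v'))"
  then show "\<omega> = eta_tilde a z (tmult a z u v)"
    by blast
qed

text \<open>
  The case \<open>f = 1\<close> says that the products of basis vectors have weighted coordinate sum zero; \<open>f = v\<close> gives the
  diagonal part of \<open>eta\<close>. The term \<open>l = i\<close> of the sum is \<open>0 / 0\<close>, which is \<open>0\<close>.
\<close>

lemma weighted_sum_tmult_basis:
  fixes z :: "complex ^ 'n::finite"
  shows "(\<Sum>m\<in>UNIV. a m * tmult_basis a z i j $ m * f m) =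
    (if i = j then \<Sum>l\<in>UNIV. a i * a l * (f i - f l) / (z $ i - z $ l)
     else - (a i * a j * (f i - f j) / (z $ i - z $ j)))"
proof -
  have off: "(\<Sum>m\<in>UNIV. a m * tmult_offdiag a z i l $ m * f m) =
      - (a i * a l * (f i - f l) / (z $ i - z $ l))" for l
  proof -
    have "(\<Sum>m\<in>UNIV. a m * tmult_offdiag a z i l $ m * f m) =
        (\<Sum>m\<in>UNIV. (if m = l then a i / (z $ i - z $ l) * (a m * f m) else 0)
                 + (if m = i then a l / (z $ l - z $ i) * (a m * f m) else 0))"
      by (intro sum.cong) (auto simp: tmult_offdiag_def axis_def algebra_simps)
    also have "\<dots> = a i / (z $ i - z $ l) * (a l * f l) + a l / (z $ l - z $ i) * (a i * f i)"
      by (simp add: sum.distrib)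
    also have "a l / (z $ l - z $ i) = - (a l / (z $ i - z $ l))"
      by (metis minus_diff_eq divide_minus_right)
    finally show ?thesis
      by (simp add: diff_divide_distrib algebra_simps)
  qed
  show ?thesis
  proof (cases "i = j")
    case True
    have "(\<Sum>m\<in>UNIV. a m * tmult_basis a z i i $ m * f m) =
        - (\<Sum>l\<in>UNIV-{i}. \<Sum>m\<in>UNIV. a m * tmult_offdiag a z i l $ m * f m)"
      by (subst sum.swap)
        (simp add: tmult_basis_def sum_distrib_left sum_distrib_right sum_negf)
    also have "\<dots> = (\<Sum>l\<in>UNIV-{i}. a i * a l * (f i - f l) / (z $ i - z $ l))"
      by (simp add: off sum_negf)
    also have "\<dots> = (\<Sum>l\<in>UNIV. a i * a l * (f i - f l) / (z $ i - z $ l))"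
      by (intro sum.mono_neutral_left) auto
    finally show ?thesis using True by simp
  next
    case False
    then show ?thesis by (simp add: tmult_basis_def off)
  qed
qed

lemma eta_tmult_basis:
  fixes z :: "complex ^ 'n::finite"
  assumes a: "\<And>k. a k \<noteq> 0" "(\<Sum>j\<in>UNIV. a j) \<noteq> 0" and inj: "inj (($) z)"
  shows "eta a z (tmult_basis a z i j) v =
    (if i = j then - (\<Sum>l\<in>UNIV. a i * a l * (v $ i - v $ l) / (z $ i - z $ l))
     else a i * a j * (v $ i - v $ j) / (z $ i - z $ j))"
proof -
  have "(\<Sum>m\<in>UNIV. a m * tmult_basis a z i j $ m) = 0"
    using weighted_sum_tmult_basis[of a z i j "\<lambda>_. 1"] by simp
  then show ?thesis
    using weighted_sum_tmult_basis[of a z i j "\<lambda>m. v $ m"] by (simp add: eta_eq[OF a inj])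
qed

section \<open>Derivatives of the prepotential\<close>

text \<open>
  Near \<open>w\<close> the branch \<open>L\<close> differs from \<open>L w\<close> by less than \<open>\<pi>\<close>, so \<open>L - L w\<close> is the principal logarithm of
  \<open>g / g w\<close>. That quotient is close to \<open>1\<close>, where the principal logarithm is differentiable.
\<close>

lemma log_branch_has_derivative:
  assumes L: "log_branch_on W g L" and W: "open W" "w \<in> W"
    and g: "(g has_derivative g') (at w)"
  shows "(L has_derivative (\<lambda>v. g' v / g w)) (at w)"
proof -
  have gw: "g w \<noteq> 0" and eL: "\<And>x. x \<in> W \<Longrightarrow> exp (L x) = g x"
    using L W(2) by (auto simp: log_branch_on_def)
  have "(L \<longlongrightarrow> L w) (at w)"
    using L W by (auto simp: log_branch_on_def continuous_on_eq_continuous_at isCont_def)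
  then have near: "\<forall>\<^sub>F x in at w. dist (L x) (L w) < pi"
    using pi_gt_zero by (rule tendstoD)
  have "\<forall>\<^sub>F x in at w. x \<in> W"
    using W by (rule eventually_at_in_open')
  with near have eq: "\<forall>\<^sub>F x in at w. L w + Ln (g x / g w) = L x"
  proof eventually_elim
    case (elim x)
    have "\<bar>Im (L x - L w)\<bar> < pi"
      using elim(1) abs_Im_le_cmod[of "L x - L w"] by (simp add: dist_norm)
    then have "Ln (exp (L x - L w)) = L x - L w"
      by (intro Ln_exp) auto
    moreover have "exp (L x - L w) = g x / g w"
      using eL elim(2) W(2) by (simp add: exp_diff)
    ultimately show ?case by simp
  qed
  have q: "((\<lambda>x. g x / g w) has_derivative (\<lambda>v. g' v / g w)) (at w)"
    by (intro has_derivative_divide' derivative_eq_intros g) (use g gw in auto)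
  have "(Ln has_derivative (*) 1) (at (g w / g w))"
    using has_field_derivative_Ln[of 1] gw by (simp add: has_field_derivative_def)
  from has_derivative_compose[OF q this]
  have "((\<lambda>x. L w + Ln (g x / g w)) has_derivative (\<lambda>v. g' v / g w)) (at w)"
    by (auto intro!: derivative_eq_intros)
  then show ?thesis
    by (rule has_derivative_transform_eventually) (use eq gw in auto)
qed

text \<open>
  A derivative in the sense of \<open>has_derivative\<close> is only real linear, so its complex linearity along
  the coordinate direction is a separate hypothesis.
\<close>

lemma partial_z_eqI:
  assumes F: "(F has_derivative F') (at w)" and F': "\<And>s. F' (s *s axis i 1) = s * c"
  shows "partial_z i F w = c"
proof -
  have line: "((\<lambda>s. w + s *s axis i 1) has_derivative (\<lambda>s. s *s axis i 1)) (at 0)"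
    using linear_conv_bounded_linear[of "\<lambda>s. s *s axis i (1::complex)"]
    by (auto intro!: derivative_eq_intros bounded_linear_imp_has_derivative linearI
        simp: vec_eq_iff algebra_simps)
  have "((\<lambda>s. F (w + s *s axis i 1)) has_derivative (\<lambda>s. F' (s *s axis i 1))) (at 0)"
    by (rule has_derivative_compose[OF line]) (use F in simp)
  then have "((\<lambda>s. F (w + s *s axis i 1)) has_field_derivative c) (at 0)"
    unfolding has_field_derivative_def
    by (rule has_derivative_eq_rhs) (simp add: F' fun_eq_iff mult.commute)
  then show ?thesis
    unfolding partial_z_def by (rule DERIV_imp_deriv)
qed

text \<open>
  The hypothesis on \<open>L\<close> says that \<open>L\<close> behaves like \<open>log x\<close>; these are the derivatives of \<open>x log x\<close> and \<open>x\<^sup>2 log x\<close>.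
\<close>

lemma has_derivative_mult_log:
  fixes x L :: "'a::real_normed_vector \<Rightarrow> complex"
  assumes x: "(x has_derivative x') (at w)"
    and L: "(L has_derivative (\<lambda>v. x' v / x w)) (at w)" and nz: "x w \<noteq> 0"
  shows "((\<lambda>y. x y * L y) has_derivative (\<lambda>v. x' v * (L w + 1))) (at w)"
    and "((\<lambda>y. x y * (x y * L y)) has_derivative (\<lambda>v. x' v * (2 * (x w * L w) + x w))) (at w)"
proof -
  show xL: "((\<lambda>y. x y * L y) has_derivative (\<lambda>v. x' v * (L w + 1))) (at w)"
    by (rule has_derivative_eq_rhs[OF has_derivative_mult[OF x L]])
      (use nz in \<open>simp add: fun_eq_iff algebra_simps\<close>)
  show "((\<lambda>y. x y * (x y * L y)) has_derivative (\<lambda>v. x' v * (2 * (x w * L w) + x w))) (at w)"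
    by (rule has_derivative_eq_rhs[OF has_derivative_mult[OF x xL]])
      (simp add: fun_eq_iff algebra_simps)
qed

text \<open>
  Along each difference \<open>x = z\<^sub>k - z\<^sub>l\<close> the successive derivatives of \<open>x\<^sup>2 log x / 2\<close> are \<open>x log x + x / 2\<close>,
  \<open>log x + 3 / 2\<close> and \<open>1 / x\<close>. The direction \<open>\<partial>\<^sub>m\<close> contributes the factor \<open>\<delta>\<^sub>m\<^sub>k - \<delta>\<^sub>m\<^sub>l\<close>.
  The first two derivatives are needed on all of \<open>W\<close>, since they are differentiated again.
\<close>

lemma prepotential_second_partials_has_derivative:
  fixes a :: "'n::{finite,linorder} \<Rightarrow> complex"
  assumes W: "open W" "z \<in> W" "W \<inter> Delta = {}" and P: "Ptilde_branch_on a W P"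
  shows "(partial_z i (partial_z j P) has_derivative
     (\<lambda>v. \<Sum>(k, l) | k < l. (axis j 1 $ k - axis j 1 $ l) * (axis i 1 $ k - axis i 1 $ l) *
            (a k * a l * (v $ k - v $ l) / (z $ k - z $ l)))) (at z)"
proof -
  obtain L where L: "\<And>k l. k < l \<Longrightarrow> log_branch_on W (\<lambda>w. w $ k - w $ l) (L k l)"
    and PL: "\<And>w. w \<in> W \<Longrightarrow>
      P w = 1 / 2 * (\<Sum>(k, l) | k < l. a k * a l * (w $ k - w $ l)\<^sup>2 * L k l w)"
    using P unfolding Ptilde_branch_on_def by blast
  have nz: "w $ k - w $ l \<noteq> 0" if "w \<in> W" "k < l" for w k l
    using W(3) that by (auto simp: Delta_def)
  have x: "((\<lambda>w. w $ k - w $ l) has_derivative (\<lambda>v. v $ k - v $ l)) (at w)" for k l and w :: "(complex, 'n) vec"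
    by (intro has_derivative_diff bounded_linear.has_derivative[OF bounded_linear_vec_nth] has_derivative_ident)
  have dL: "(L k l has_derivative (\<lambda>v. (v $ k - v $ l) / (w $ k - w $ l))) (at w)"
    if "w \<in> W" "k < l" for w k l
    by (rule log_branch_has_derivative[OF L[OF that(2)] W(1) that(1) x])
  define e :: "'n \<Rightarrow> 'n \<Rightarrow> 'n \<Rightarrow> complex" where "e m k l = axis m 1 $ k - axis m 1 $ l" for m k l
  have e: "(s *s axis m 1) $ k - (s *s axis m 1) $ l = s * e m k l" for s m k l
    by (simp add: e_def right_diff_distrib)
  have first: "partial_z j P w = (\<Sum>(k, l) | k < l. a k * a l * e j k l *
      ((w $ k - w $ l) * L k l w + (w $ k - w $ l) / 2))" if w: "w \<in> W" for w
  proof (rule partial_z_eqI)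
    let ?P' = "\<lambda>v. \<Sum>(k, l) | k < l. a k * a l / 2 * ((v $ k - v $ l) *
       (2 * ((w $ k - w $ l) * L k l w) + (w $ k - w $ l)))"
    have "((\<lambda>y. a k * a l / 2 * ((y $ k - y $ l) * ((y $ k - y $ l) * L k l y))) has_derivative
        (\<lambda>v. a k * a l / 2 * ((v $ k - v $ l) * (2 * ((w $ k - w $ l) * L k l w) + (w $ k - w $ l)))))
        (at w)" if "k < l" for k l
      by (intro has_derivative_mult_right has_derivative_mult_log(2) x dL[OF w that] nz[OF w that])
    then have "((\<lambda>y. \<Sum>(k, l) | k < l. a k * a l / 2 * ((y $ k - y $ l) * ((y $ k - y $ l) * L k l y)))
        has_derivative ?P') (at w)"
      by (intro has_derivative_sum) auto
    then show "(P has_derivative ?P') (at w)"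
      by (rule has_derivative_transform_within_open[OF _ W(1) w])
        (simp add: PL sum_divide_distrib power2_eq_square mult.assoc case_prod_unfold)
    show "?P' (s *s axis j 1) = s * (\<Sum>(k, l) | k < l. a k * a l * e j k l *
        ((w $ k - w $ l) * L k l w + (w $ k - w $ l) / 2))" for s
    proof -
      have "b / 2 * ((s * d) * (2 * p + y)) = s * (b * d * (p + y / 2))" for b d p y :: complex
        by (simp add: field_simps)
      then show ?thesis
        unfolding e sum_distrib_left case_prod_unfold by (intro sum.cong refl)
    qed
  qed
  have second: "partial_z i (partial_z j P) w = (\<Sum>(k, l) | k < l. a k * a l * e j k l * e i k l *
      (L k l w + 3 / 2))" if w: "w \<in> W" for w
  proof (rule partial_z_eqI)
    let ?P' = "\<lambda>v. \<Sum>(k, l) | k < l. a k * a l * e j k l * ((v $ k - v $ l) * (L k l w + 1) +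
       (v $ k - v $ l) / 2)"
    have "((\<lambda>y. a k * a l * e j k l * ((y $ k - y $ l) * L k l y + (y $ k - y $ l) / 2)) has_derivative
        (\<lambda>v. a k * a l * e j k l * ((v $ k - v $ l) * (L k l w + 1) + (v $ k - v $ l) / 2))) (at w)"
      if "k < l" for k l
      by (intro has_derivative_mult_right has_derivative_add has_derivative_mult_log(1)
          bounded_linear.has_derivative[OF bounded_linear_divide] x dL[OF w that] nz[OF w that])
    then have "((\<lambda>y. \<Sum>(k, l) | k < l. a k * a l * e j k l * ((y $ k - y $ l) * L k l y + (y $ k - y $ l) / 2))
        has_derivative ?P') (at w)"
      by (intro has_derivative_sum) auto
    then show "(partial_z j P has_derivative ?P') (at w)"
      by (rule has_derivative_transform_within_open[OF _ W(1) w]) (simp add: first)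
    show "?P' (s *s axis i 1) =
        s * (\<Sum>(k, l) | k < l. a k * a l * e j k l * e i k l * (L k l w + 3 / 2))" for s
    proof -
      have "b * (s * d * (p + 1) + s * d / 2) = s * (b * d * (p + 3 / 2))" for b d p :: complex
        by (simp add: field_simps)
      then show ?thesis
        unfolding e sum_distrib_left case_prod_unfold by (intro sum.cong refl)
    qed
  qed
  have "((\<lambda>w. L k l w + 3 / 2) has_derivative (\<lambda>v. (v $ k - v $ l) / (z $ k - z $ l))) (at z)"
    if "k < l" for k l
    using has_derivative_add[OF dL[OF W(2) that] has_derivative_const] by simp
  then have "((\<lambda>w. a k * a l * e j k l * e i k l * (L k l w + 3 / 2)) has_derivative
      (\<lambda>v. a k * a l * e j k l * e i k l * ((v $ k - v $ l) / (z $ k - z $ l)))) (at z)"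
    if "k < l" for k l
    using that by (intro has_derivative_mult_right)
  then have "((\<lambda>w. \<Sum>(k, l) | k < l. a k * a l * e j k l * e i k l * (L k l w + 3 / 2)) has_derivative
      (\<lambda>v. \<Sum>(k, l) | k < l. a k * a l * e j k l * e i k l * ((v $ k - v $ l) / (z $ k - z $ l)))) (at z)"
    by (intro has_derivative_sum) auto
  then have "(partial_z i (partial_z j P) has_derivative
      (\<lambda>v. \<Sum>(k, l) | k < l. a k * a l * e j k l * e i k l * ((v $ k - v $ l) / (z $ k - z $ l)))) (at z)"
    by (rule has_derivative_transform_within_open[OF _ W(1,2)]) (simp add: second)
  then show ?thesis
    unfolding e_def[symmetric]
    by (rule has_derivative_eq_rhs) (simp add: fun_eq_iff case_prod_unfold mult_ac)
qed

section \<open>Comparison of the two sides\<close>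

text \<open>
  By symmetry the sum over \<open>k < l\<close> is half the sum over all pairs, and expanding the product of
  differences of Kronecker symbols there leaves four terms, equal in pairs.
\<close>

lemma sum_over_pairs_axis_differences:
  fixes c :: "'n::{finite,linorder} \<Rightarrow> 'n \<Rightarrow> complex"
  assumes sym: "\<And>k l. c k l = c l k" and diag: "\<And>k. c k k = 0"
  shows "(\<Sum>(k, l) | k < l. (axis j 1 $ k - axis j 1 $ l) * (axis i 1 $ k - axis i 1 $ l) * c k l) =
    (if i = j then \<Sum>l\<in>UNIV. c i l else - c i j)"
proof -
  define d where "d k l = (axis j 1 $ k - axis j 1 $ l) * (axis i 1 $ k - axis i 1 $ l) * c k l" for k l
  have "(\<Sum>(k, l)\<in>UNIV. d k l) = (\<Sum>(k, l)\<in>{(k, l). k < l} \<union> {(k, l). l < k}. d k l)"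
    by (rule sum.mono_neutral_right) (auto simp: d_def diag not_less_iff_gr_or_eq)
  also have "\<dots> = (\<Sum>(k, l) | k < l. d k l) + (\<Sum>(k, l) | l < k. d k l)"
    by (rule sum.union_disjoint) auto
  also have "(\<Sum>(k, l) | l < k. d k l) = (\<Sum>(k, l) | k < l. d k l)"
    by (rule sum.reindex_bij_witness[of _ prod.swap prod.swap])
      (auto simp: d_def sym algebra_simps)
  finally have two: "2 * (\<Sum>(k, l) | k < l. d k l) = (\<Sum>k\<in>UNIV. \<Sum>l\<in>UNIV. d k l)"
    by (simp add: sum.cartesian_product)
  have delta: "(\<Sum>l\<in>UNIV. axis m 1 $ l * f l) = f m" for f :: "'n \<Rightarrow> complex" and m
  proof -
    have "(\<Sum>l\<in>UNIV. axis m 1 $ l * f l) = (\<Sum>l\<in>UNIV. if l = m then f l else 0)"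
      by (intro sum.cong) (auto simp: axis_def)
    then show ?thesis by simp
  qed
  have "(\<Sum>k\<in>UNIV. \<Sum>l\<in>UNIV. d k l) =
      (\<Sum>k\<in>UNIV. axis j 1 $ k * (axis i 1 $ k * (\<Sum>l\<in>UNIV. c k l)))
    - (\<Sum>k\<in>UNIV. axis j 1 $ k * (\<Sum>l\<in>UNIV. axis i 1 $ l * c k l))
    - (\<Sum>k\<in>UNIV. axis i 1 $ k * (\<Sum>l\<in>UNIV. axis j 1 $ l * c k l))
    + (\<Sum>k\<in>UNIV. \<Sum>l\<in>UNIV. axis j 1 $ l * (axis i 1 $ l * c k l))"
  proof -
    have "d k l = axis j 1 $ k * (axis i 1 $ k * c k l) - axis j 1 $ k * (axis i 1 $ l * c k l)
        - axis i 1 $ k * (axis j 1 $ l * c k l) + axis j 1 $ l * (axis i 1 $ l * c k l)" for k l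
      by (simp add: d_def algebra_simps)
    then show ?thesis
      by (simp add: sum.distrib sum_subtractf sum_distrib_left)
  qed
  also have "\<dots> = axis i 1 $ j * (\<Sum>l\<in>UNIV. c j l) - c j i - c i j + axis i 1 $ j * (\<Sum>l\<in>UNIV. c l j)"
    unfolding delta sum_distrib_left[of "axis i 1 $ j"] ..
  also have "\<dots> = 2 * (if i = j then \<Sum>l\<in>UNIV. c i l else - c i j)"
  proof -
    have "(\<Sum>l\<in>UNIV. c l j) = (\<Sum>l\<in>UNIV. c j l)"
      by (intro sum.cong refl sym)
    then show ?thesis
      using sym[of j i] by (cases "i = j") (simp_all add: axis_def diag)
  qed
  finally show ?thesis
    using two by (simp add: d_def)
qed

theorem theorem4p22:
  fixes a :: "'n::{finite,linorder} \<Rightarrow> complex"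
    and z :: "(complex, 'n) vec"
    and W :: "(complex, 'n) vec set"
    and P :: "(complex, 'n) vec \<Rightarrow> complex"
    and i j :: 'n
  assumes "CARD('n) \<ge> 2"
    and "\<And>k. a k \<noteq> 0"
    and "(\<Sum>k\<in>UNIV. a k) \<noteq> 0"
    and "z \<in> UNIV - Delta"
    and "open W" and "z \<in> W" and "W \<subseteq> UNIV - Delta"
    and "Ptilde_branch_on a W P"
  shows "(partial_z i (partial_z j P) has_derivative
            (\<lambda>v. - Bmult a z (eta_tilde a z (axis i 1)) (eta_tilde a z (axis j 1)) v)) (at z)"
proof -
  have inj: "inj (($) z)"
    using assms(4) by (auto simp: Delta_def inj_def) (metis linorder_neqE)
  let ?c = "\<lambda>v k l. a k * a l * (v $ k - v $ l) / (z $ k - z $ l)"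
  have sym: "?c v k l = ?c v l k" for v k l
  proof -
    have "?c v k l = - (a k * a l * (v $ k - v $ l)) / - (z $ k - z $ l)"
      by (rule minus_divide_divide[symmetric])
    also have "- (a k * a l * (v $ k - v $ l)) = a l * a k * (v $ l - v $ k)"
      by (simp add: algebra_simps)
    also have "- (z $ k - z $ l) = z $ l - z $ k" by simp
    finally show ?thesis .
  qed
  have "(\<Sum>(k, l) | k < l. (axis j 1 $ k - axis j 1 $ l) * (axis i 1 $ k - axis i 1 $ l) * ?c v k l) =
      - Bmult a z (eta_tilde a z (axis i 1)) (eta_tilde a z (axis j 1)) v" for v
    unfolding Bmult_eta_tilde[OF assms(2,3) inj] tmult_axis
    unfolding eta_tilde_def eta_tmult_basis[OF assms(2,3) inj]
    by (subst sum_over_pairs_axis_differences[of "?c v", OF sym]) auto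
  moreover have "W \<inter> Delta = {}" using assms(7) by auto
  ultimately show ?thesis
    using prepotential_second_partials_has_derivative[OF assms(5,6) _ assms(8), of i j] by simp
qed

end
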